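(* Let $\mathcal{B}$ be the canonical basis of 2-roots of type $Y_{a,b,c}$ ($a,b,c\ge1$), let $\alpha\vee\beta\in\mathcal{B}$ (with $\alpha$ a simple root and $\beta$ elementary with respect to $\alpha$, or vice versa), and let $\gamma$ be a simple root of $W$. Then $$s_\gamma(\alpha\vee\beta)=\begin{cases}\alpha\vee\beta & \text{if } B(\alpha,\gamma)=B(\beta,\gamma)=0;\\ -\alpha\vee\beta & \text{if }\gamma\in\{\alpha,\beta\};\\ (\alpha\vee\beta)+(\gamma\vee v) & \text{otherwise, for some } (\gamma\vee v)\in\mathcal{B}.\end{cases}$$ Furthermore, the basis element $\gamma\vee v$ appearing above satisfies $w(\alpha\vee\beta)=\gamma\vee v$ for some $w\in\langle s_\alpha,s_\beta,s_\gamma\rangle$.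
   Context: $Y_{a,b,c}$ ($a,b,c\ge1$) is the tree with $n=a+b+c+1$ vertices consisting of three paths with $a$, $b$ and $c$ vertices, each joined by one of its endpoints to a common trivalent branch vertex. Its Cartan matrix $A$ has $A_{ii}=2$, $A_{ij}=-1$ if $i,j$ are adjacent, and $A_{ij}=0$ otherwise. $W$ is the group generated by $s_1,\dots,s_n$ subject to $s_i^2=1$, $s_is_j=s_js_i$ if $A_{ij}=0$, and $s_is_js_i=s_js_is_j$ if $A_{ij}=-1$. $V$ is the real vector space with basis the simple roots $\Pi=\{\alpha_1,\dots,\alpha_n\}$, with symmetric bilinear form $B(\alpha_i,\alpha_j)=A_{ij}$, on which $W$ acts by $s_i(v)=v-B(\alpha_i,v)\alpha_i$. A real root is a vector $w(\alpha_i)$ with $w\in W$; the reflection of $\alpha=w(\alpha_i)$ is $s_\alpha=ws_iw^{-1}$, acting by $v\mapsto v-B(\alpha,v)\alpha$. For $\alpha,\beta\in V$, $\alpha\vee\beta=\alpha\otimes\beta+\beta\otimes\alpha$; $S^2(V)\subseteq V\otimes V$ is the span of these elements, with the diagonal $W$-action. Elementary roots. The highest root of a type $D_m$ ($m\ge4$) root system is the sum of the simple roots with coefficient $1$ at the endpoints of the diagram and $2$ at all other vertices. For a simple root $\alpha_i$, a positive root $\beta$ is called elementary with respect to $\alpha_i$ if one of the following holds: (1) $\beta=\alpha_j$ is a simple root with $A_{ij}=0$; (2) $\beta=\alpha_h+\alpha_i+\alpha_j$ for a path $h$--$i$--$j$ in $Y_{a,b,c}$ (with middle vertex $i$); (3)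 $i$ is not the branch vertex and $\beta=\theta_i$, where $\theta_i$ is the highest root of the standard parabolic subsystem of type $D_m$ ($m\ge 4$) whose simple roots are those on the path from $i$ to the branch vertex together with all neighbours of the branch vertex. The canonical basis $\mathcal{B}=\mathcal{B}(a,b,c)$ is the set of all $\alpha_i\vee\beta\in S^2(V)$ with $\alpha_i\in\Pi$ and $\beta$ elementary with respect to $\alpha_i$. *)

theory Defs
  imports "HOL-Analysis.Finite_Function_Topology" "HOL-Algebra.Generated_Groups"
begin

section \<open>The diagram\<close>

datatype arm = Arm1 | Arm2 | Arm3

text \<open>\<open>On p k\<close> is the vertex at distance \<open>k \<ge> 1\<close> from the branch vertex on the arm \<open>p\<close>.\<close>

datatype vertex = Branch | On arm nat

fun arm_length :: "nat \<Rightarrow> nat \<Rightarrow> nat \<Rightarrow> arm \<Rightarrow> nat" where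
  "arm_length a b c Arm1 = a"
| "arm_length a b c Arm2 = b"
| "arm_length a b c Arm3 = c"

definition vertices :: "nat \<Rightarrow> nat \<Rightarrow> nat \<Rightarrow> vertex set" where
  "vertices a b c = insert Branch {On p k |p k. 1 \<le> k \<and> k \<le> arm_length a b c p}"

fun adj :: "vertex \<Rightarrow> vertex \<Rightarrow> bool" where
  "adj Branch Branch \<longleftrightarrow> False"
| "adj Branch (On p k) \<longleftrightarrow> k = 1"
| "adj (On p k) Branch \<longleftrightarrow> k = 1"
| "adj (On p k) (On q l) \<longleftrightarrow> p = q \<and> (l = Suc k \<or> k = Suc l)"

definition cartan :: "vertex \<Rightarrow> vertex \<Rightarrow> int" where
  "cartan i j = (if i = j then 2 else if adj i j then -1 else 0)"


section \<open>The Coxeter group\<close>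

text \<open>
  The group is presented by words in the generators modulo the congruence generated by the
  defining relations. Formal inverses of the generators are not needed, since each generator
  is its own inverse by the relation \<open>sq\<close>.
\<close>

inductive cox_eq :: "nat \<Rightarrow> nat \<Rightarrow> nat \<Rightarrow> vertex list \<Rightarrow> vertex list \<Rightarrow> bool"
  for a b c :: nat where
  sq: "i \<in> vertices a b c \<Longrightarrow> cox_eq a b c [i, i] []"
| commute: "i \<in> vertices a b c \<Longrightarrow> j \<in> vertices a b c \<Longrightarrow> cartan i j = 0
    \<Longrightarrow> cox_eq a b c [i, j] [j, i]"
| braid: "i \<in> vertices a b c \<Longrightarrow> j \<in> vertices a b c \<Longrightarrow> cartan i j = -1
    \<Longrightarrow> cox_eq a b c [i, j, i] [j, i, j]"
| refl: "u \<in> lists (vertices a b c) \<Longrightarrow> cox_eq a b c u u"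
| sym: "cox_eq a b c u v \<Longrightarrow> cox_eq a b c v u"
| trans: "cox_eq a b c u v \<Longrightarrow> cox_eq a b c v w \<Longrightarrow> cox_eq a b c u w"
| mult: "cox_eq a b c u v \<Longrightarrow> cox_eq a b c u' v' \<Longrightarrow> cox_eq a b c (u @ u') (v @ v')"

definition cox_rel :: "nat \<Rightarrow> nat \<Rightarrow> nat \<Rightarrow> (vertex list \<times> vertex list) set" where
  "cox_rel a b c = {(u, v). cox_eq a b c u v}"

definition cox_class :: "nat \<Rightarrow> nat \<Rightarrow> nat \<Rightarrow> vertex list \<Rightarrow> vertex list set" where
  "cox_class a b c u = cox_rel a b c `` {u}"

definition cox_group :: "nat \<Rightarrow> nat \<Rightarrow> nat \<Rightarrow> vertex list set monoid" where
  "cox_group a b c =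
    \<lparr>carrier = lists (vertices a b c) // cox_rel a b c,
     mult = (\<lambda>X Y. \<Union>x\<in>X. \<Union>y\<in>Y. cox_class a b c (x @ y)),
     one = cox_class a b c []\<rparr>"

definition gen :: "nat \<Rightarrow> nat \<Rightarrow> nat \<Rightarrow> vertex \<Rightarrow> vertex list set" where
  "gen a b c i = cox_class a b c [i]"

lemma cox_eq_lists:
  "cox_eq a b c u v \<Longrightarrow> u \<in> lists (vertices a b c) \<and> v \<in> lists (vertices a b c)"
  by (induction rule: cox_eq.induct) auto

lemma equiv_cox_rel: "equiv (lists (vertices a b c)) (cox_rel a b c)"
proof (intro equivI refl_onI symI transI)
  show "cox_rel a b c \<subseteq> lists (vertices a b c) \<times> lists (vertices a b c)"
    unfolding cox_rel_def using cox_eq_lists by blast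
qed (auto simp: cox_rel_def cox_eq.refl dest: cox_eq.sym cox_eq.trans)

lemma cox_class_eq_iff:
  assumes "u \<in> lists (vertices a b c)" "v \<in> lists (vertices a b c)"
  shows "cox_class a b c u = cox_class a b c v \<longleftrightarrow> cox_eq a b c u v"
  using eq_equiv_class_iff[OF equiv_cox_rel assms] by (simp add: cox_class_def cox_rel_def)

lemma carrier_cox_group:
  "carrier (cox_group a b c) = cox_class a b c ` lists (vertices a b c)"
  by (auto simp: cox_group_def quotient_def cox_class_def)

lemma mult_cox_group:
  assumes u: "u \<in> lists (vertices a b c)" and v: "v \<in> lists (vertices a b c)"
  shows "cox_class a b c u \<otimes>\<^bsub>cox_group a b c\<^esub> cox_class a b c v = cox_class a b c (u @ v)"
proof -
  have "cox_class a b c (x @ y) = cox_class a b c (u @ v)"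
    if "x \<in> cox_class a b c u" "y \<in> cox_class a b c v" for x y
  proof -
    have *: "cox_eq a b c u x" "cox_eq a b c v y"
      using that by (auto simp: cox_class_def cox_rel_def)
    then have "cox_eq a b c (x @ y) (u @ v)"
      by (rule cox_eq.sym[OF cox_eq.mult])
    then show ?thesis
      using cox_class_eq_iff cox_eq_lists by blast
  qed
  moreover have "u \<in> cox_class a b c u" "v \<in> cox_class a b c v"
    using u v by (auto simp: cox_class_def cox_rel_def intro: cox_eq.refl)
  ultimately have "(\<Union>x\<in>cox_class a b c u. \<Union>y\<in>cox_class a b c v. cox_class a b c (x @ y)) =
      cox_class a b c (u @ v)"
    by blast
  then show ?thesis by (simp add: cox_group_def)
qed

lemma cox_eq_rev_append: "u \<in> lists (vertices a b c) \<Longrightarrow> cox_eq a b c (rev u @ u) []"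
proof (induction u)
  case Nil
  then show ?case by (simp add: cox_eq.refl)
next
  case (Cons i u)
  then have i: "i \<in> vertices a b c" and u: "u \<in> lists (vertices a b c)" by auto
  have ru: "rev u \<in> lists (vertices a b c)" using u by auto
  have "cox_eq a b c (rev u @ [i, i] @ u) (rev u @ [] @ u)"
    by (rule cox_eq.mult[OF cox_eq.refl[OF ru] cox_eq.mult[OF cox_eq.sq[OF i] cox_eq.refl[OF u]]])
  then have "cox_eq a b c (rev (i # u) @ i # u) (rev u @ u)" by simp
  then show ?case using Cons.IH[OF u] by (rule cox_eq.trans)
qed

lemma group_cox_group: "group (cox_group a b c)"
proof (rule groupI)
  show "\<one>\<^bsub>cox_group a b c\<^esub> \<in> carrier (cox_group a b c)"
    by (subst carrier_cox_group) (auto simp: cox_group_def)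
next
  fix x assume "x \<in> carrier (cox_group a b c)"
  then obtain u where u: "u \<in> lists (vertices a b c)" "x = cox_class a b c u"
    by (auto simp: carrier_cox_group)
  have one: "\<one>\<^bsub>cox_group a b c\<^esub> = cox_class a b c []" by (simp add: cox_group_def)
  show "\<one>\<^bsub>cox_group a b c\<^esub> \<otimes>\<^bsub>cox_group a b c\<^esub> x = x"
    unfolding one u(2) using u(1) by (subst mult_cox_group) auto
  have r: "rev u \<in> lists (vertices a b c)" using u by auto
  have "cox_class a b c (rev u) \<otimes>\<^bsub>cox_group a b c\<^esub> x = \<one>\<^bsub>cox_group a b c\<^esub>"
    unfolding one u(2) using u(1) r cox_eq_rev_append[OF u(1)]
    by (subst mult_cox_group) (auto simp: cox_class_eq_iff)
  then show "\<exists>y\<in>carrier (cox_group a b c). y \<otimes>\<^bsub>cox_group a b c\<^esub> x = \<one>\<^bsub>cox_group a b c\<^esub>"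
    using r by (auto simp: carrier_cox_group)
next
  fix x y assume "x \<in> carrier (cox_group a b c)" "y \<in> carrier (cox_group a b c)"
  then obtain u v where "u \<in> lists (vertices a b c)" "x = cox_class a b c u"
    "v \<in> lists (vertices a b c)" "y = cox_class a b c v"
    unfolding carrier_cox_group by blast
  then show "x \<otimes>\<^bsub>cox_group a b c\<^esub> y \<in> carrier (cox_group a b c)"
    by (simp only: carrier_cox_group mult_cox_group append_in_lists_conv image_eqI)
next
  fix x y z assume "x \<in> carrier (cox_group a b c)" "y \<in> carrier (cox_group a b c)"
    "z \<in> carrier (cox_group a b c)"
  then obtain u v w where "u \<in> lists (vertices a b c)" "x = cox_class a b c u"
    "v \<in> lists (vertices a b c)" "y = cox_class a b c v"
    "w \<in> lists (vertices a b c)" "z = cox_class a b c w"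
    unfolding carrier_cox_group by blast
  then show "x \<otimes>\<^bsub>cox_group a b c\<^esub> y \<otimes>\<^bsub>cox_group a b c\<^esub> z =
      x \<otimes>\<^bsub>cox_group a b c\<^esub> (y \<otimes>\<^bsub>cox_group a b c\<^esub> z)"
    by (simp only: mult_cox_group append_in_lists_conv append_assoc)
qed


section \<open>The representation on \<open>V\<close>, and roots\<close>

text \<open>
  Vectors are finitely supported real functions on the vertices; \<open>root_space a b c\<close> is the
  space \<open>V\<close> spanned by the simple roots.
\<close>

type_synonym vec = "vertex \<Rightarrow>\<^sub>0 real"

definition simple :: "vertex \<Rightarrow> vec" where
  "simple i = Poly_Mapping.single i 1"

definition simple_roots :: "nat \<Rightarrow> nat \<Rightarrow> nat \<Rightarrow> vec set" where
  "simple_roots a b c = simple ` vertices a b c"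

definition root_space :: "nat \<Rightarrow> nat \<Rightarrow> nat \<Rightarrow> vec set" where
  "root_space a b c = span (simple_roots a b c)"

definition form :: "vec \<Rightarrow> vec \<Rightarrow> real" where
  "form x y = (\<Sum>i\<in>Poly_Mapping.keys x. \<Sum>j\<in>Poly_Mapping.keys y.
     Poly_Mapping.lookup x i * Poly_Mapping.lookup y j * real_of_int (cartan i j))"

definition simple_reflection :: "vertex \<Rightarrow> vec \<Rightarrow> vec" where
  "simple_reflection i v = v - form (simple i) v *\<^sub>R simple i"

definition act_word :: "vertex list \<Rightarrow> vec \<Rightarrow> vec" where
  "act_word u v = foldr simple_reflection u v"

text \<open>All words representing \<open>g\<close> act in the same way; see \<open>act_cox_class\<close> below.\<close>

definition act :: "vertex list set \<Rightarrow> vec \<Rightarrow> vec" where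
  "act g v = the_elem ((\<lambda>u. act_word u v) ` g)"

lemma form_superset:
  assumes "finite I" "finite J" "Poly_Mapping.keys x \<subseteq> I" "Poly_Mapping.keys y \<subseteq> J"
  shows "form x y = (\<Sum>i\<in>I. \<Sum>j\<in>J.
    Poly_Mapping.lookup x i * Poly_Mapping.lookup y j * real_of_int (cartan i j))"
proof -
  have "form x y = (\<Sum>i\<in>Poly_Mapping.keys x. \<Sum>j\<in>J.
    Poly_Mapping.lookup x i * Poly_Mapping.lookup y j * real_of_int (cartan i j))"
    unfolding form_def using assms
    by (intro sum.cong sum.mono_neutral_left refl) (auto simp: in_keys_iff)
  also have "\<dots> = (\<Sum>i\<in>I. \<Sum>j\<in>J.
    Poly_Mapping.lookup x i * Poly_Mapping.lookup y j * real_of_int (cartan i j))"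
    using assms by (intro sum.mono_neutral_left) (auto simp: in_keys_iff)
  finally show ?thesis .
qed

lemma lookup_scaleR: "Poly_Mapping.lookup (r *\<^sub>R x) i = r * Poly_Mapping.lookup (x :: vec) i"
proof -
  have "finite {i. r * Poly_Mapping.lookup x i \<noteq> 0}"
    by (rule finite_subset[OF _ finite_keys[of x]]) (auto simp: in_keys_iff)
  then show ?thesis
    by (simp add: scaleR_poly_mapping_def Abs_poly_mapping_inverse)
qed

lemma form_add_right: "form x (y + z) = form x y + form x z"
proof -
  let ?J = "Poly_Mapping.keys y \<union> Poly_Mapping.keys z"
  have "Poly_Mapping.keys (y + z) \<subseteq> ?J" by (rule keys_add)
  then show ?thesis
    using form_superset[of "Poly_Mapping.keys x" ?J x "y + z"]
      form_superset[of "Poly_Mapping.keys x" ?J x y] form_superset[of "Poly_Mapping.keys x" ?J x z]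
    by (simp add: lookup_add algebra_simps sum.distrib)
qed

lemma form_scaleR_right: "form x (r *\<^sub>R y) = r * form x y"
proof -
  have "Poly_Mapping.keys (r *\<^sub>R y) \<subseteq> Poly_Mapping.keys y"
    by (auto simp: in_keys_iff lookup_scaleR)
  then show ?thesis
    using form_superset[of "Poly_Mapping.keys x" "Poly_Mapping.keys y" x "r *\<^sub>R y"]
    by (simp add: lookup_scaleR form_def sum_distrib_left algebra_simps)
qed

lemma form_diff_right: "form x (y - z) = form x y - form x z"
  using form_add_right[of x "y - z" z] by simp

lemma form_simple: "form (simple i) (simple j) = real_of_int (cartan i j)"
  by (simp add: form_def simple_def)

lemma adj_commute: "adj i j = adj j i"
  by (cases i; cases j) auto

lemma cartan_commute: "cartan i j = cartan j i"
  by (simp add: cartan_def adj_commute)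

lemma act_word_cox_eq: "cox_eq a b c u v \<Longrightarrow> act_word u x = act_word v x"
proof (induction arbitrary: x rule: cox_eq.induct)
  case (sq i)
  then show ?case
    by (simp add: act_word_def simple_reflection_def form_diff_right form_scaleR_right
        form_simple cartan_def)
next
  case (commute i j)
  then show ?case using cartan_commute[of i j]
    by (simp add: act_word_def simple_reflection_def form_diff_right form_scaleR_right
        form_simple)
next
  case (braid i j)
  moreover have "cartan i i = 2" "cartan j j = 2" by (simp_all add: cartan_def)
  ultimately show ?case using cartan_commute[of i j]
    by (simp add: act_word_def simple_reflection_def form_diff_right form_add_right
        form_scaleR_right form_simple algebra_simps)
qed (auto simp: act_word_def)

lemma act_cox_class:
  assumes "u \<in> lists (vertices a b c)"
  shows "act (cox_class a b c u) x = act_word u x"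
proof -
  have "act_word v x = act_word u x" if "v \<in> cox_class a b c u" for v
    using that act_word_cox_eq[of a b c u v x] by (simp add: cox_class_def cox_rel_def)
  moreover have "u \<in> cox_class a b c u"
    using assms by (simp add: cox_class_def cox_rel_def cox_eq.refl)
  ultimately have "(\<lambda>v. act_word v x) ` cox_class a b c u = {act_word u x}" by blast
  then show ?thesis by (simp add: act_def)
qed

definition real_roots :: "nat \<Rightarrow> nat \<Rightarrow> nat \<Rightarrow> vec set" where
  "real_roots a b c = {act w (simple i) |w i. w \<in> carrier (cox_group a b c) \<and> i \<in> vertices a b c}"

definition positive_roots :: "nat \<Rightarrow> nat \<Rightarrow> nat \<Rightarrow> vec set" where
  "positive_roots a b c = {\<beta> \<in> real_roots a b c. \<forall>i. Poly_Mapping.lookup \<beta> i \<ge> 0}"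

text \<open>
  The reflection \<open>w s\<^sub>i w\<^sup>-\<^sup>1\<close> of the real root \<open>\<alpha> = w(\<alpha>\<^sub>i)\<close>, as a group element. Each choice of
  \<open>w\<close> and \<open>i\<close> yields an element acting by \<open>v \<mapsto> v - B(\<alpha>, v) \<alpha>\<close>, and \<open>W\<close> acts faithfully
  on \<open>V\<close>, so the element does not depend on the choice.
\<close>

definition reflection :: "nat \<Rightarrow> nat \<Rightarrow> nat \<Rightarrow> vec \<Rightarrow> vertex list set" where
  "reflection a b c \<alpha> = (SOME g. \<exists>w\<in>carrier (cox_group a b c). \<exists>i\<in>vertices a b c.
     \<alpha> = act w (simple i) \<and>
     g = w \<otimes>\<^bsub>cox_group a b c\<^esub> gen a b c i \<otimes>\<^bsub>cox_group a b c\<^esub> inv\<^bsub>cox_group a b c\<^esub> w)"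


section \<open>Symmetric tensors\<close>

text \<open>\<open>V \<otimes> V\<close> is the space with basis the pairs of vertices, \<open>(i, j)\<close> standing for
  \<open>\<alpha>\<^sub>i \<otimes> \<alpha>\<^sub>j\<close>.\<close>

type_synonym tensor2 = "(vertex \<times> vertex) \<Rightarrow>\<^sub>0 real"

definition tensor :: "vec \<Rightarrow> vec \<Rightarrow> tensor2" where
  "tensor x y = (\<Sum>i\<in>Poly_Mapping.keys x. \<Sum>j\<in>Poly_Mapping.keys y.
     Poly_Mapping.single (i, j) (Poly_Mapping.lookup x i * Poly_Mapping.lookup y j))"

definition vee :: "vec \<Rightarrow> vec \<Rightarrow> tensor2" where
  "vee x y = tensor x y + tensor y x"

text \<open>The diagonal action: the linear extension of
  \<open>\<alpha>\<^sub>i \<otimes> \<alpha>\<^sub>j \<mapsto> g \<alpha>\<^sub>i \<otimes> g \<alpha>\<^sub>j\<close>.\<close>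

definition act2 :: "vertex list set \<Rightarrow> tensor2 \<Rightarrow> tensor2" where
  "act2 g T = (\<Sum>(i, j)\<in>Poly_Mapping.keys T.
     Poly_Mapping.lookup T (i, j) *\<^sub>R tensor (act g (simple i)) (act g (simple j)))"


section \<open>Elementary roots and the canonical basis\<close>

text \<open>The highest root of the subsystem of type \<open>D\<^sub>m\<close> whose simple roots are indexed by \<open>S\<close>.\<close>

definition D_highest_root :: "vertex set \<Rightarrow> vec" where
  "D_highest_root S = (\<Sum>v\<in>S. (if card {u \<in> S. adj u v} = 1 then 1 else 2) *\<^sub>R simple v)"

text \<open>The vertices of the path from a vertex to the branch vertex, both included.\<close>

fun path_to_branch :: "vertex \<Rightarrow> vertex set" where
  "path_to_branch Branch = {Branch}"
| "path_to_branch (On p k) = insert Branch {On p l |l. 1 \<le> l \<and> l \<le> k}"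

definition theta :: "nat \<Rightarrow> nat \<Rightarrow> nat \<Rightarrow> vertex \<Rightarrow> vec" where
  "theta a b c i =
    D_highest_root (path_to_branch i \<union> {v \<in> vertices a b c. adj v Branch})"

definition elementary :: "nat \<Rightarrow> nat \<Rightarrow> nat \<Rightarrow> vertex \<Rightarrow> vec \<Rightarrow> bool" where
  "elementary a b c i \<beta> \<longleftrightarrow> \<beta> \<in> positive_roots a b c \<and>
    ((\<exists>j\<in>vertices a b c. cartan i j = 0 \<and> \<beta> = simple j) \<or>
     (\<exists>h\<in>vertices a b c. \<exists>j\<in>vertices a b c. h \<noteq> j \<and> adj h i \<and> adj i j \<and>
        \<beta> = simple h + simple i + simple j) \<or>
     (i \<noteq> Branch \<and> \<beta> = theta a b c i))"

text \<open>\<open>elementary_pair a b c \<alpha> \<beta>\<close>: \<open>\<alpha>\<close> is a simple root and \<open>\<beta>\<close> is elementary with respect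
  to it.\<close>

definition elementary_pair :: "nat \<Rightarrow> nat \<Rightarrow> nat \<Rightarrow> vec \<Rightarrow> vec \<Rightarrow> bool" where
  "elementary_pair a b c \<alpha> \<beta> \<longleftrightarrow>
    (\<exists>i\<in>vertices a b c. \<alpha> = simple i \<and> elementary a b c i \<beta>)"

definition canonical_basis :: "nat \<Rightarrow> nat \<Rightarrow> nat \<Rightarrow> tensor2 set" where
  "canonical_basis a b c = {vee \<alpha> \<beta> |\<alpha> \<beta>. elementary_pair a b c \<alpha> \<beta>}"

end

theory Submission
  imports Defs
begin

text \<open>
  Let \<open>\<alpha> = \<alpha>\<^sub>i\<close>, let \<open>\<beta>\<close> be elementary with respect to \<open>\<alpha>\<close>, and let \<open>\<gamma> = \<alpha>\<^sub>k\<close>.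
  Put \<open>x = B(\<alpha>, \<gamma>)\<close> and \<open>y = B(\<beta>, \<gamma>)\<close>. An elementary root is orthogonal to its simple root
  (\<open>elementary_shape_orthogonal\<close>), which settles \<open>\<gamma> \<in> {\<alpha>, \<beta>}\<close>: one factor changes sign and
  the other is fixed. For the third case, expanding the reflection gives
  \<open>s\<^sub>\<gamma>(\<alpha> \<or> \<beta>) = \<alpha> \<or> \<beta> + \<gamma> \<or> (x y \<gamma> - x \<beta> - y \<alpha>)\<close>.

  If \<open>x = -1\<close>, the new factor is \<open>v = \<beta> - y \<alpha> - y \<gamma>\<close>, which is exactly \<open>s\<^sub>\<alpha> s\<^sub>\<gamma> \<beta>\<close>, while
  \<open>s\<^sub>\<alpha> s\<^sub>\<gamma> \<alpha> = \<gamma>\<close>; so \<open>w = s\<^sub>\<alpha> s\<^sub>\<gamma>\<close> carries \<open>\<alpha> \<or> \<beta>\<close> to \<open>\<gamma> \<or> v\<close>, whatever \<open>y\<close> is. This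
  also shows that \<open>v\<close> is a real root, and its coefficients are visibly nonnegative once it is known
  to have one of the three elementary shapes. That is \<open>elementary_shape_transport\<close>: moving from a
  vertex to an adjacent one turns an elementary root for the first into one for the second. Most
  of its content is the relation \<open>\<theta>\<^sub>k\<^sub>+\<^sub>1 = \<theta>\<^sub>k + \<alpha>\<^sub>k + \<alpha>\<^sub>k\<^sub>+\<^sub>1\<close> between the highest roots along an arm
  (\<open>theta_Suc\<close>), and, at the branch vertex, the fact that adding the branch root and the third
  neighbour to a path through the branch vertex gives the highest root of type \<open>D\<^sub>4\<close>
  (\<open>theta_one\<close>).

  If \<open>x = 0\<close>, then \<open>y = -1\<close> is the only nonzero possibility (\<open>elementary_shape_pairing\<close>). The same
  identities with \<open>\<alpha>\<close> and \<open>\<beta>\<close> exchanged give \<open>v = \<alpha>\<close> and \<open>w = s\<^sub>\<beta> s\<^sub>\<gamma>\<close>, and \<open>\<gamma> \<or> \<alpha>\<close> is a pair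
  of orthogonal simple roots.
\<close>

section \<open>Linearity of the form and of the action\<close>

lemma form_commute: "form x y = form y x"
  unfolding form_def
  by (subst sum.swap) (simp add: cartan_commute mult.commute mult.left_commute)

lemma form_add_left: "form (x + y) z = form x z + form y z"
  by (simp add: form_commute[of _ z] form_add_right)

lemma form_diff_left: "form (x - y) z = form x z - form y z"
  by (simp add: form_commute[of _ z] form_diff_right)

lemma form_scaleR_left: "form (r *\<^sub>R x) z = r * form x z"
  by (simp add: form_commute[of _ z] form_scaleR_right)

lemmas form_bilinear = form_add_left form_add_right form_diff_left form_diff_right
  form_scaleR_left form_scaleR_right

lemma linear_simple_reflection: "linear (simple_reflection i)"
  by (rule linearI) (simp_all add: simple_reflection_def form_add_right form_scaleR_right algebra_simps)

lemma linear_act_word: "linear (act_word u)"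
proof (induction u)
  case Nil
  have "act_word [] = id" by (simp add: act_word_def fun_eq_iff)
  then show ?case by (simp only: linear_id)
next
  case (Cons i u)
  have "act_word (i # u) = simple_reflection i \<circ> act_word u"
    by (simp add: act_word_def fun_eq_iff)
  then show ?case by (simp only: linear_compose[OF Cons linear_simple_reflection])
qed

lemma form_act_word: "form (act_word u x) (act_word u y) = form x y"
proof (induction u)
  case (Cons i u)
  have "form (simple_reflection i v) (simple_reflection i w) = form v w" for v w
    using form_simple[of i i] form_commute[of "simple i" v]
    by (simp add: simple_reflection_def form_bilinear cartan_def algebra_simps)
  with Cons show ?case by (simp add: act_word_def)
qed (simp add: act_word_def)

lemma vec_expansion: "x = (\<Sum>i\<in>Poly_Mapping.keys x. Poly_Mapping.lookup x i *\<^sub>R simple i)"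
proof (rule poly_mapping_eqI)
  fix k
  have "Poly_Mapping.lookup x k =
      (\<Sum>i\<in>Poly_Mapping.keys x. if i = k then Poly_Mapping.lookup x i else 0)"
    by (simp add: in_keys_iff)
  also have "\<dots> = Poly_Mapping.lookup
      (\<Sum>i\<in>Poly_Mapping.keys x. Poly_Mapping.lookup x i *\<^sub>R simple i) k"
    unfolding lookup_sum lookup_scaleR simple_def lookup_single
    by (rule sum.cong) (simp_all add: when_def)
  finally show "Poly_Mapping.lookup x k = Poly_Mapping.lookup
      (\<Sum>i\<in>Poly_Mapping.keys x. Poly_Mapping.lookup x i *\<^sub>R simple i) k" .
qed


section \<open>The diagonal action on symmetric tensors\<close>

lemma lookup_tensor:
  "Poly_Mapping.lookup (tensor x y) (i, j) = Poly_Mapping.lookup x i * Poly_Mapping.lookup y j"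
proof -
  have "Poly_Mapping.lookup (tensor x y) (i, j) =
     (\<Sum>k\<in>Poly_Mapping.keys x. \<Sum>l\<in>Poly_Mapping.keys y.
        (if k = i then Poly_Mapping.lookup x k else 0) *
        (if l = j then Poly_Mapping.lookup y l else 0))"
    by (auto simp: tensor_def lookup_sum lookup_single when_def intro!: sum.cong)
  also have "\<dots> =
     (\<Sum>k\<in>Poly_Mapping.keys x. if k = i then Poly_Mapping.lookup x k else 0) *
     (\<Sum>l\<in>Poly_Mapping.keys y. if l = j then Poly_Mapping.lookup y l else 0)"
    by (simp only: sum_product)
  finally show ?thesis by (simp add: in_keys_iff)
qed

lemma lookup_tensor_scaleR:
  "Poly_Mapping.lookup (r *\<^sub>R T) i = r * Poly_Mapping.lookup (T :: tensor2) i"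
proof -
  have "finite {i. r * Poly_Mapping.lookup T i \<noteq> 0}"
    by (rule finite_subset[OF _ finite_keys[of T]]) (auto simp: in_keys_iff)
  then show ?thesis by (simp add: scaleR_poly_mapping_def Abs_poly_mapping_inverse)
qed

lemma keys_tensor: "Poly_Mapping.keys (tensor x y) = Poly_Mapping.keys x \<times> Poly_Mapping.keys y"
  by (auto simp: in_keys_iff lookup_tensor)

lemma linear_tensor_left: "linear (\<lambda>x. tensor x y)"
  by (rule linearI; rule poly_mapping_eqI)
    (auto simp: lookup_tensor lookup_add lookup_scaleR lookup_tensor_scaleR algebra_simps)

lemma linear_tensor_right: "linear (tensor x)"
  by (rule linearI; rule poly_mapping_eqI)
    (auto simp: lookup_tensor lookup_add lookup_scaleR lookup_tensor_scaleR algebra_simps)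

lemma vee_commute: "vee x y = vee y x"
  by (simp add: vee_def add.commute)

lemma vee_add_left: "vee (x + y) z = vee x z + vee y z"
  by (simp add: vee_def linear_add[OF linear_tensor_left] linear_add[OF linear_tensor_right])

lemma vee_scaleR_left: "vee (r *\<^sub>R x) z = r *\<^sub>R vee x z"
  by (simp add: vee_def linear_scale[OF linear_tensor_left] linear_scale[OF linear_tensor_right]
      scaleR_add_right)

lemma vee_diff_left: "vee (x - y) z = vee x z - vee y z"
  using vee_add_left[of "x - y" y z] by simp

lemma vee_add_right: "vee x (y + z) = vee x y + vee x z"
  by (simp only: vee_commute[of x] vee_add_left)

lemma vee_scaleR_right: "vee x (r *\<^sub>R y) = r *\<^sub>R vee x y"
  by (simp only: vee_commute[of x] vee_scaleR_left)

lemma vee_diff_right: "vee x (y - z) = vee x y - vee x z"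
  by (simp only: vee_commute[of x] vee_diff_left)

lemmas vee_bilinear = vee_add_left vee_add_right vee_diff_left vee_diff_right
  vee_scaleR_left vee_scaleR_right

lemma act2_superset:
  assumes "finite K" "Poly_Mapping.keys T \<subseteq> K"
  shows "act2 g T = (\<Sum>(i, j)\<in>K.
    Poly_Mapping.lookup T (i, j) *\<^sub>R tensor (act g (simple i)) (act g (simple j)))"
  unfolding act2_def using assms by (intro sum.mono_neutral_left) (auto simp: in_keys_iff)

lemma act2_add: "act2 g (S + T) = act2 g S + act2 g T"
proof -
  let ?K = "Poly_Mapping.keys S \<union> Poly_Mapping.keys T"
  show ?thesis
    using act2_superset[of ?K "S + T" g] act2_superset[of ?K S g] act2_superset[of ?K T g]
      keys_add[of S T]
    by (simp add: lookup_add scaleR_add_left sum.distrib case_prod_unfold)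
qed

text \<open>
  The diagonal action is defined on the basis tensors; linearity of \<open>g\<close> on \<open>V\<close> is what makes it
  apply \<open>g\<close> to each factor of an arbitrary decomposable tensor.
\<close>

lemma act2_tensor:
  assumes "linear (act g)"
  shows "act2 g (tensor x y) = tensor (act g x) (act g y)"
proof -
  let ?X = "Poly_Mapping.keys x" and ?Y = "Poly_Mapping.keys y"
  let ?x = "Poly_Mapping.lookup x" and ?y = "Poly_Mapping.lookup y"
  have expand: "act g z =
      (\<Sum>i\<in>Poly_Mapping.keys z. Poly_Mapping.lookup z i *\<^sub>R act g (simple i))" for z
    by (subst vec_expansion) (simp add: linear_sum[OF assms] linear_scale[OF assms])
  have "act2 g (tensor x y) =
      (\<Sum>i\<in>?X. \<Sum>j\<in>?Y. (?x i * ?y j) *\<^sub>R tensor (act g (simple i)) (act g (simple j)))"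
    by (simp add: act2_def keys_tensor lookup_tensor sum.cartesian_product)
  also have "\<dots> = (\<Sum>i\<in>?X. ?x i *\<^sub>R tensor (act g (simple i)) (act g y))"
    by (simp add: expand[of y] linear_sum[OF linear_tensor_right]
        linear_scale[OF linear_tensor_right] scaleR_sum_right)
  also have "\<dots> = tensor (act g x) (act g y)"
    by (simp add: expand[of x] linear_sum[OF linear_tensor_left]
        linear_scale[OF linear_tensor_left])
  finally show ?thesis .
qed

lemma act2_vee: "linear (act g) \<Longrightarrow> act2 g (vee x y) = vee (act g x) (act g y)"
  by (simp add: vee_def act2_add act2_tensor)


section \<open>Reflections in real roots\<close>

lemma act_one: "act \<one>\<^bsub>cox_group a b c\<^esub> v = v"
  using act_cox_class[of "[]" a b c v] by (simp add: cox_group_def act_word_def)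

lemma act_gen: "i \<in> vertices a b c \<Longrightarrow> act (gen a b c i) v = simple_reflection i v"
  using act_cox_class[of "[i]" a b c v] by (simp add: gen_def act_word_def)

lemma gen_in_carrier: "i \<in> vertices a b c \<Longrightarrow> gen a b c i \<in> carrier (cox_group a b c)"
  by (simp add: gen_def carrier_cox_group)

lemma act_eq_act_word:
  assumes "g \<in> carrier (cox_group a b c)"
  obtains u where "act g = act_word u"
proof -
  from assms obtain u where "u \<in> lists (vertices a b c)" "g = cox_class a b c u"
    unfolding carrier_cox_group by blast
  then have "act g = act_word u" by (intro ext) (simp only: act_cox_class)
  then show ?thesis by (rule that)
qed

lemma linear_act: "g \<in> carrier (cox_group a b c) \<Longrightarrow> linear (act g)"
  by (erule act_eq_act_word) (simp only: linear_act_word)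

lemma form_act: "g \<in> carrier (cox_group a b c) \<Longrightarrow> form (act g x) (act g y) = form x y"
  by (erule act_eq_act_word) (simp only: form_act_word)

lemma act_mult:
  assumes "g \<in> carrier (cox_group a b c)" "h \<in> carrier (cox_group a b c)"
  shows "act (g \<otimes>\<^bsub>cox_group a b c\<^esub> h) v = act g (act h v)"
proof -
  from assms obtain u w where u: "u \<in> lists (vertices a b c)" "g = cox_class a b c u"
    and w: "w \<in> lists (vertices a b c)" "h = cox_class a b c w"
    unfolding carrier_cox_group by blast
  have uw: "u @ w \<in> lists (vertices a b c)" using u w by simp
  then show ?thesis
    unfolding u(2) w(2) mult_cox_group[OF u(1) w(1)]
      act_cox_class[OF u(1)] act_cox_class[OF w(1)] act_cox_class[OF uw]
    by (simp add: act_word_def)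
qed

lemma act_in_root_space:
  assumes "g \<in> carrier (cox_group a b c)" "v \<in> root_space a b c"
  shows "act g v \<in> root_space a b c"
proof -
  obtain u where u: "u \<in> lists (vertices a b c)" "g = cox_class a b c u"
    using assms unfolding carrier_cox_group by blast
  have "act_word u v \<in> root_space a b c"
    using u(1) assms(2)
  proof (induction u)
    case (Cons i u)
    moreover from Cons have "simple i \<in> root_space a b c"
      unfolding root_space_def simple_roots_def by (intro span_base) simp
    ultimately show ?case
      unfolding act_word_def root_space_def
      by (simp add: simple_reflection_def span_diff span_scale)
  qed (simp add: act_word_def)
  then show ?thesis using u by (simp add: act_cox_class)
qed

lemma real_root_act:
  assumes "\<beta> \<in> real_roots a b c" "g \<in> carrier (cox_group a b c)"
  shows "act g \<beta> \<in> real_roots a b c"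
proof -
  interpret group "cox_group a b c" by (rule group_cox_group)
  obtain w i where "w \<in> carrier (cox_group a b c)" "i \<in> vertices a b c" "\<beta> = act w (simple i)"
    using assms(1) by (auto simp: real_roots_def)
  then have "act g \<beta> = act (g \<otimes>\<^bsub>cox_group a b c\<^esub> w) (simple i)"
    "g \<otimes>\<^bsub>cox_group a b c\<^esub> w \<in> carrier (cox_group a b c)"
    using assms(2) by (simp_all add: act_mult)
  then show ?thesis
    using \<open>i \<in> vertices a b c\<close> unfolding real_roots_def by blast
qed

lemma simple_real_root: "i \<in> vertices a b c \<Longrightarrow> simple i \<in> real_roots a b c"
proof -
  interpret group "cox_group a b c" by (rule group_cox_group)
  assume "i \<in> vertices a b c"
  then have "\<exists>w\<in>carrier (cox_group a b c). simple i = act w (simple i)"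
    by (intro bexI[of _ "\<one>\<^bsub>cox_group a b c\<^esub>"]) (simp_all add: act_one)
  then show ?thesis using \<open>i \<in> vertices a b c\<close> unfolding real_roots_def by blast
qed

lemma simple_in_root_space: "i \<in> vertices a b c \<Longrightarrow> simple i \<in> root_space a b c"
  unfolding root_space_def simple_roots_def by (intro span_base) simp

lemma real_root_in_root_space: "\<beta> \<in> real_roots a b c \<Longrightarrow> \<beta> \<in> root_space a b c"
  by (auto simp: real_roots_def intro!: act_in_root_space simple_in_root_space)

lemma form_real_root: "\<beta> \<in> real_roots a b c \<Longrightarrow> form \<beta> \<beta> = 2"
  by (auto simp: real_roots_def form_act form_simple cartan_def)

text \<open>
  Whichever \<open>w\<close> and \<open>i\<close> the choice operator picks with \<open>\<alpha> = w \<alpha>\<^sub>i\<close>, invariance of the form turns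
  \<open>w s\<^sub>i w\<^sup>-\<^sup>1 v = v - B(\<alpha>\<^sub>i, w\<^sup>-\<^sup>1 v) w \<alpha>\<^sub>i\<close> into a formula
  that depends on \<open>\<alpha>\<close> alone.
\<close>

lemma reflection_act:
  assumes "\<alpha> \<in> real_roots a b c"
  shows "reflection a b c \<alpha> \<in> carrier (cox_group a b c)"
    and "act (reflection a b c \<alpha>) v = v - form \<alpha> v *\<^sub>R \<alpha>"
proof -
  interpret group "cox_group a b c" by (rule group_cox_group)
  have "\<exists>g. \<exists>w\<in>carrier (cox_group a b c). \<exists>i\<in>vertices a b c. \<alpha> = act w (simple i) \<and>
     g = w \<otimes>\<^bsub>cox_group a b c\<^esub> gen a b c i \<otimes>\<^bsub>cox_group a b c\<^esub> inv\<^bsub>cox_group a b c\<^esub> w"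
    using assms by (auto simp: real_roots_def)
  from someI_ex[OF this] obtain w i where w: "w \<in> carrier (cox_group a b c)"
    and i: "i \<in> vertices a b c" and \<alpha>: "\<alpha> = act w (simple i)"
    and g: "reflection a b c \<alpha> =
      w \<otimes>\<^bsub>cox_group a b c\<^esub> gen a b c i \<otimes>\<^bsub>cox_group a b c\<^esub> inv\<^bsub>cox_group a b c\<^esub> w"
    unfolding reflection_def by blast
  have gi: "gen a b c i \<in> carrier (cox_group a b c)" using i by (rule gen_in_carrier)
  show "reflection a b c \<alpha> \<in> carrier (cox_group a b c)"
    unfolding g using w gi by simp
  define v' where "v' = act (inv\<^bsub>cox_group a b c\<^esub> w) v"
  have v: "act w v' = v"
    unfolding v'_def using w act_mult[OF w, of "inv\<^bsub>cox_group a b c\<^esub> w"] by (simp add: act_one)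
  have "act (reflection a b c \<alpha>) v = act w (simple_reflection i v')"
    unfolding g v'_def using w gi i by (simp add: act_mult act_gen)
  also have "\<dots> = act w v' - form (simple i) v' *\<^sub>R act w (simple i)"
    unfolding simple_reflection_def
    by (simp add: linear_diff[OF linear_act[OF w]] linear_scale[OF linear_act[OF w]])
  also have "form (simple i) v' = form \<alpha> v"
    using form_act[OF w, of "simple i" v'] by (simp add: v \<alpha>)
  finally show "act (reflection a b c \<alpha>) v = v - form \<alpha> v *\<^sub>R \<alpha>"
    by (simp add: v \<alpha>)
qed


section \<open>Highest roots of the subsystems of type D\<close>

text \<open>The neighbour of \<open>On p k\<close> in the direction of the branch vertex.\<close>

definition rootward :: "arm \<Rightarrow> nat \<Rightarrow> vertex" where
  "rootward p k = (if k = 1 then Branch else On p (k - 1))"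

lemma lookup_simple: "Poly_Mapping.lookup (simple i) v = (if i = v then 1 else 0)"
  by (simp add: simple_def lookup_single when_def)

lemma lookup_D_highest_root:
  assumes "finite S"
  shows "Poly_Mapping.lookup (D_highest_root S) v =
    (if v \<in> S then if card {u \<in> S. adj u v} = 1 then 1 else 2 else 0)"
proof -
  have "Poly_Mapping.lookup (D_highest_root S) v =
    (\<Sum>w\<in>S. if w = v then if card {u \<in> S. adj u v} = 1 then 1 else 2 else 0)"
    unfolding D_highest_root_def lookup_sum lookup_scaleR lookup_simple
    by (rule sum.cong) auto
  then show ?thesis using assms by simp
qed

text \<open>
  The diagram of \<open>\<theta>\<close> at \<open>On p k\<close> has three endpoints: \<open>On p k\<close> itself and the neighbours of the
  branch vertex on the other two arms. Counting the neighbours of each vertex inside the diagram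
  identifies them and gives explicit coefficients.
\<close>

lemma lookup_theta:
  assumes "a \<ge> 1" "b \<ge> 1" "c \<ge> 1" "k \<ge> 1"
  shows "Poly_Mapping.lookup (theta a b c (On p k)) v =
    (case v of
       Branch \<Rightarrow> 2
     | On q l \<Rightarrow> if q = p then if 1 \<le> l \<and> l < k then 2 else if l = k then 1 else 0
                else if l = 1 then 1 else 0)"
proof -
  define S where "S = path_to_branch (On p k) \<union> {v \<in> vertices a b c. adj v Branch}"
  have arm: "arm_length a b c q \<ge> 1" for q using assms by (cases q) auto
  have adjB: "adj u Branch \<longleftrightarrow> u \<in> {On Arm1 1, On Arm2 1, On Arm3 1}" for u
  proof (cases u)
    case (On q l)
    then show ?thesis by (cases q) auto
  qed simp
  have Branch_S: "Branch \<in> S" by (simp add: S_def)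
  have On_S: "On q l \<in> S \<longleftrightarrow> l = 1 \<or> (q = p \<and> 1 \<le> l \<and> l \<le> k)" for q l
    using arm[of q] assms(4) by (auto simp: S_def vertices_def)
  have S_eq: "S = {Branch, On Arm1 1, On Arm2 1, On Arm3 1} \<union> On p ` {1..k}"
  proof (rule Set.set_eqI)
    fix u show "u \<in> S \<longleftrightarrow> u \<in> {Branch, On Arm1 1, On Arm2 1, On Arm3 1} \<union> On p ` {1..k}"
    proof (cases u)
      case (On q l)
      then show ?thesis by (cases q) (auto simp: On_S)
    qed (simp add: Branch_S)
  qed
  have fin: "finite S" unfolding S_eq by simp
  have lookup: "Poly_Mapping.lookup (theta a b c (On p k)) v =
    (if v \<in> S then if card {u \<in> S. adj u v} = 1 then 1 else 2 else 0)"
    unfolding theta_def S_def[symmetric] using fin by (rule lookup_D_highest_root)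
  show ?thesis
  proof (cases v)
    case Branch
    have "{u \<in> S. adj u v} = {On Arm1 1, On Arm2 1, On Arm3 1}"
      unfolding Branch adjB by (auto simp: On_S)
    then show ?thesis using Branch Branch_S lookup by simp
  next
    case (On q l)
    show ?thesis
    proof (cases "v \<in> S")
      case False
      then show ?thesis using On On_S lookup assms(4) by auto
    next
      case True
      have l: "l \<ge> 1" using True On On_S[of q l] by auto
      have nbrs: "{u \<in> S. adj u v} =
          insert (rootward q l) (if q = p \<and> l < k then {On p (Suc l)} else {})"
      proof (rule Set.set_eqI)
        fix u show "u \<in> {u \<in> S. adj u v} \<longleftrightarrow>
          u \<in> insert (rootward q l) (if q = p \<and> l < k then {On p (Suc l)} else {})"
        proof (cases u)
          case u: Branch
          then show ?thesis using On Branch_S by (auto simp: rootward_def)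
        next
          case u: (On r m)
          then show ?thesis using On True l by (auto simp: rootward_def On_S)
        qed
      qed
      have "rootward s l \<noteq> On p (Suc l)" for s by (auto simp: rootward_def)
      then have "card {u \<in> S. adj u v} = (if q = p \<and> l < k then 2 else 1)"
        unfolding nbrs by simp
      then show ?thesis using True On On_S[of q l] lookup assms(4) l by auto
    qed
  qed
qed

lemma other_arms:
  fixes p :: arm
  obtains q r where "p \<noteq> q" "p \<noteq> r" "q \<noteq> r"
  using that[of Arm2 Arm3] that[of Arm1 Arm3] that[of Arm1 Arm2] by (cases p) simp_all

text \<open>
  The highest root of type \<open>D\<^sub>4\<close>, grouped as a path \<open>q\<close>--branch--\<open>r\<close> plus the branch root plus the
  third neighbour, which is the form in which it arises by reflecting that path.
\<close>

lemma theta_one: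
  assumes "a \<ge> 1" "b \<ge> 1" "c \<ge> 1" and "p \<noteq> q" "p \<noteq> r" "q \<noteq> r"
  shows "theta a b c (On p 1) = simple (On q 1) + simple Branch + simple (On r 1)
    + simple Branch + simple (On p 1)"
proof (rule poly_mapping_eqI)
  fix v
  have "s = p \<or> s = q \<or> s = r" for s
    using assms(4-6) by (cases p; cases q; cases r; cases s) simp_all
  then show "Poly_Mapping.lookup (theta a b c (On p 1)) v = Poly_Mapping.lookup
    (simple (On q 1) + simple Branch + simple (On r 1) + simple Branch + simple (On p 1)) v"
    using assms by (subst lookup_theta) (auto simp: lookup_add lookup_simple split: vertex.splits)
qed

text \<open>
  Lengthening the arm by one vertex raises the coefficient of the former endpoint from 1 to 2 and
  creates a new endpoint of coefficient 1.
\<close>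

lemma theta_Suc:
  assumes "a \<ge> 1" "b \<ge> 1" "c \<ge> 1" "k \<ge> 1"
  shows "theta a b c (On p (Suc k)) = theta a b c (On p k) + simple (On p k) + simple (On p (Suc k))"
  using assms
  by (intro poly_mapping_eqI) (auto simp: lookup_theta lookup_add lookup_simple split: vertex.splits)

text \<open>
  Only the vertex next to the end of the long arm pairs to 1 with the highest root; it is the node to
  which the affine node of type \<open>D\<close> would be attached (for \<open>k = 1\<close>, the branch vertex). Inside its
  subsystem a highest root is dominant, so the value \<open>-1\<close> comes from the vertices just outside.
  The induction adds the contributions of the two simple roots in \<open>theta_Suc\<close>.
\<close>

lemma form_theta:
  assumes "a \<ge> 1" "b \<ge> 1" "c \<ge> 1" "k \<ge> 1" "v \<in> vertices a b c"
  shows "form (theta a b c (On p k)) (simple v) =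
    (if v = rootward p k then 1
     else if v = On p (Suc k) \<or> (\<exists>q. q \<noteq> p \<and> v = On q 2) then -1 else 0)"
  using assms(4)
proof (induction k rule: nat_induct_at_least)
  case base
  obtain q r where qr: "p \<noteq> q" "p \<noteq> r" "q \<noteq> r"
    by (rule other_arms)
  then have arms: "s = p \<or> s = q \<or> s = r" for s
    by (cases p; cases q; cases r; cases s) simp_all
  show ?case
  proof (cases v)
    case Branch
    then show ?thesis
      unfolding theta_one[OF assms(1-3) qr]
      by (simp add: form_add_left form_simple cartan_def rootward_def)
  next
    case (On s l)
    then show ?thesis
      using arms[of s] assms(5) qr unfolding theta_one[OF assms(1-3) qr]
      by (auto simp: form_add_left form_simple cartan_def rootward_def vertices_def)
  qed
next
  case (Suc k)
  show ?case
    using Suc assms unfolding theta_Suc[OF assms(1-3) Suc.hyps]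
    by (cases v) (auto simp: form_add_left form_simple cartan_def rootward_def vertices_def)
qed


section \<open>Local structure of elementary roots\<close>

text \<open>
  The three forms of an elementary root without the requirement of being a positive root. The two
  parts are proved separately: the shape by inspecting the diagram, positivity by transporting real
  roots through the group.
\<close>

definition elementary_shape :: "nat \<Rightarrow> nat \<Rightarrow> nat \<Rightarrow> vertex \<Rightarrow> vec \<Rightarrow> bool" where
  "elementary_shape a b c i \<beta> \<longleftrightarrow>
     (\<exists>j\<in>vertices a b c. cartan i j = 0 \<and> \<beta> = simple j) \<or>
     (\<exists>h\<in>vertices a b c. \<exists>j\<in>vertices a b c. h \<noteq> j \<and> adj h i \<and> adj i j \<and>
        \<beta> = simple h + simple i + simple j) \<or>
     (i \<noteq> Branch \<and> \<beta> = theta a b c i)"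

lemma elementary_iff_shape:
  "elementary a b c i \<beta> \<longleftrightarrow> \<beta> \<in> positive_roots a b c \<and> elementary_shape a b c i \<beta>"
  by (simp add: elementary_def elementary_shape_def)

lemma elementary_shape_cases [consumes 2, case_names simple path theta]:
  assumes "elementary_shape a b c i \<beta>" "i \<in> vertices a b c"
  obtains j where "j \<in> vertices a b c" "cartan i j = 0" "\<beta> = simple j"
  | h j where "h \<in> vertices a b c" "j \<in> vertices a b c" "h \<noteq> j" "adj h i" "adj i j"
      "\<beta> = simple h + simple i + simple j"
  | p k where "i = On p k" "k \<ge> 1" "\<beta> = theta a b c (On p k)"
proof -
  have "\<exists>p k. i = On p k \<and> k \<ge> 1" if "i \<noteq> Branch"
    using that assms(2) by (auto simp: vertices_def)
  with assms(1) that show ?thesis unfolding elementary_shape_def by blast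
qed

lemma adj_irrefl: "\<not> adj i i"
  by (cases i) auto

lemma adj_no_triangle: "adj h i \<Longrightarrow> adj i j \<Longrightarrow> \<not> adj h j"
  by (cases h; cases i; cases j) auto

text \<open>This and the preceding lemma hold because the diagram is a tree.\<close>

lemma adj_no_quadrangle: "adj h i \<Longrightarrow> adj i j \<Longrightarrow> h \<noteq> j \<Longrightarrow> i \<noteq> k \<Longrightarrow> \<not> (adj h k \<and> adj j k)"
  by (cases h; cases i; cases j; cases k) auto

lemma adj_trivalent:
  assumes "adj h i" "adj j i" "adj k i" "h \<noteq> j" "h \<noteq> k" "j \<noteq> k"
    and "{h, j, k} \<subseteq> vertices a b c"
  obtains p q r where "i = Branch" "h = On p 1" "j = On q 1" "k = On r 1"
  using assms by (cases h; cases i; cases j; cases k) (auto simp: vertices_def)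

lemma elementary_shape_nonneg:
  assumes "a \<ge> 1" "b \<ge> 1" "c \<ge> 1" "i \<in> vertices a b c" "elementary_shape a b c i \<beta>"
  shows "Poly_Mapping.lookup \<beta> v \<ge> 0"
  using assms(5,4)
proof (cases rule: elementary_shape_cases)
  case (theta p k)
  then show ?thesis using assms(1-3) by (auto simp: lookup_theta split: vertex.splits)
qed (auto simp: lookup_add lookup_simple)

lemma elementary_shape_orthogonal:
  assumes "a \<ge> 1" "b \<ge> 1" "c \<ge> 1" "i \<in> vertices a b c" "elementary_shape a b c i \<beta>"
  shows "form \<beta> (simple i) = 0"
  using assms(5,4)
proof (cases rule: elementary_shape_cases)
  case (simple j)
  then show ?thesis by (simp add: form_simple cartan_commute)
next
  case (path h j)
  then show ?thesis
    using adj_irrefl adj_commute by (auto simp: form_add_left form_simple cartan_def)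
next
  case (theta p k)
  then show ?thesis using assms by (auto simp: form_theta rootward_def)
qed

text \<open>
  Unless \<open>\<beta> = \<alpha>\<^sub>k\<close>, a positive value would need a vertex \<open>k\<close> adjacent to \<open>i\<close>: for a path \<open>h\<close>--\<open>i\<close>--\<open>j\<close> it would be an
  end of the path, for \<open>\<theta>\<^sub>i\<close> the vertex next to \<open>i\<close> towards the branch vertex. A value below \<open>-1\<close> would
  need \<open>k\<close> to be adjacent to both ends of the path, closing a cycle.
\<close>

lemma elementary_shape_pairing:
  assumes abc: "a \<ge> 1" "b \<ge> 1" "c \<ge> 1" and i: "i \<in> vertices a b c" and k: "k \<in> vertices a b c"
    and "elementary_shape a b c i \<beta>" and ik: "cartan i k = 0" and "\<beta> \<noteq> simple k"
  shows "form \<beta> (simple k) \<in> {0, -1}"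
  using assms(6) i
proof (cases rule: elementary_shape_cases)
  case (simple j)
  then show ?thesis using assms(8) by (auto simp: form_simple cartan_def)
next
  case (path h j)
  have nik: "i \<noteq> k" "\<not> adj i k" using ik by (auto simp: cartan_def split: if_splits)
  then have "h \<noteq> k" "j \<noteq> k" using path adj_commute by blast+
  with path nik show ?thesis
    using adj_no_quadrangle[of h i j k] by (auto simp: form_add_left form_simple cartan_def)
next
  case (theta p l)
  have "\<not> adj i k" using ik by (auto simp: cartan_def split: if_splits)
  then have "k \<noteq> rootward p l" using theta by (auto simp: rootward_def)
  then show ?thesis using theta abc k by (simp add: form_theta)
qed

text \<open>
  The transported vector is \<open>s\<^sub>i s\<^sub>k \<beta>\<close>. The shape changes as follows. An orthogonal simple root \<open>\<alpha>\<^sub>j\<close>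
  stays one, or becomes the path \<open>i\<close>--\<open>k\<close>--\<open>j\<close>. A path \<open>h\<close>--\<open>i\<close>--\<open>j\<close> becomes the simple root
  of one of its ends when \<open>k\<close> is the other end; otherwise \<open>i\<close> has three neighbours and is the branch
  vertex, and the path becomes \<open>\<theta>\<^sub>k\<close>. Finally \<open>\<theta>\<^sub>i\<close> becomes \<open>\<theta>\<^sub>k\<close>, or a path through the branch
  vertex when \<open>k\<close> is that vertex.
\<close>

lemma elementary_shape_transport:
  assumes abc: "a \<ge> 1" "b \<ge> 1" "c \<ge> 1" and i: "i \<in> vertices a b c" and k: "k \<in> vertices a b c"
    and "elementary_shape a b c i \<beta>" and ik: "adj i k"
  shows "elementary_shape a b c k
    (\<beta> - form \<beta> (simple k) *\<^sub>R simple i - form \<beta> (simple k) *\<^sub>R simple k)"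
  using assms(6) i
proof (cases rule: elementary_shape_cases)
  case (simple j)
  have "j \<noteq> k" "i \<noteq> j" using simple ik by (auto simp: cartan_def split: if_splits)
  show ?thesis
  proof (cases "adj k j")
    case True
    then have y: "form \<beta> (simple k) = -1"
      using simple \<open>j \<noteq> k\<close> adj_commute by (simp add: form_simple cartan_def)
    have "\<beta> - form \<beta> (simple k) *\<^sub>R simple i - form \<beta> (simple k) *\<^sub>R simple k =
        simple i + simple k + simple j"
      unfolding y by (simp add: simple algebra_simps)
    then show ?thesis
      using True ik i simple \<open>i \<noteq> j\<close> unfolding elementary_shape_def by blast
  next
    case False
    then have kj: "cartan k j = 0" using \<open>j \<noteq> k\<close> by (simp add: cartan_def)
    then have "form \<beta> (simple k) = 0" using simple by (simp add: form_simple cartan_commute)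
    then show ?thesis using simple kj unfolding elementary_shape_def by auto
  qed
next
  case (path h j)
  have irr: "i \<noteq> k" "h \<noteq> i" "i \<noteq> j" using ik path adj_irrefl by blast+
  have hj: "\<not> adj h j" "\<not> adj j h" using adj_no_triangle[of h i j] path adj_commute by auto
  have sym: "adj k i" "adj i h" "adj j i" using ik path adj_commute by blast+
  show ?thesis
  proof (cases "k = h \<or> k = j")
    case True
    (* m is the end of the path other than k; s_i s_k removes k and i from the path. *)
    define m where "m = (if k = h then j else h)"
    have m: "\<beta> = simple k + simple i + simple m" "m \<in> vertices a b c" "cartan k m = 0"
      using True path hj by (auto simp: m_def cartan_def)
    have "form \<beta> (simple k) = 1"
      using m irr ik by (simp add: form_add_left form_simple cartan_commute[of m] cartan_def[of k k]
          cartan_def[of i k])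
    then have "\<beta> - form \<beta> (simple k) *\<^sub>R simple i - form \<beta> (simple k) *\<^sub>R simple k = simple m"
      using m(1) by simp
    then show ?thesis using m unfolding elementary_shape_def by auto
  next
    case False
    obtain p q r where B: "i = Branch" "h = On p 1" "j = On q 1" "k = On r 1"
      by (rule adj_trivalent[of h i j k a b c]) (use path sym False k ik in auto)
    then have y: "form \<beta> (simple k) = -1"
      using False path by (auto simp: form_add_left form_simple cartan_def)
    have "\<beta> - form \<beta> (simple k) *\<^sub>R simple i - form \<beta> (simple k) *\<^sub>R simple k = theta a b c k"
      unfolding y using B False path theta_one[OF abc, of r p q] by simp
    then show ?thesis using B unfolding elementary_shape_def by simp
  qed
next
  case (theta p l)
  consider "k = rootward p l" | "k = On p (Suc l)"
    using ik theta k by (cases k) (auto simp: rootward_def vertices_def)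
  then show ?thesis
  proof cases
    case 1
    then have y: "form \<beta> (simple k) = 1" using theta abc k by (simp add: form_theta)
    show ?thesis
    proof (cases "l = 1")
      case True
      obtain q r where qr: "p \<noteq> q" "p \<noteq> r" "q \<noteq> r" by (rule other_arms)
      have kB: "k = Branch" using 1 True by (simp add: rootward_def)
      have "\<beta> - form \<beta> (simple k) *\<^sub>R simple i - form \<beta> (simple k) *\<^sub>R simple k =
          simple (On q 1) + simple k + simple (On r 1)"
        unfolding y using theta True kB theta_one[OF abc qr] by simp
      moreover have "On s 1 \<in> vertices a b c" for s
        using abc by (cases s) (auto simp: vertices_def)
      ultimately show ?thesis using qr kB unfolding elementary_shape_def
        by (intro disjI2 disjI1 bexI[of _ "On q 1"] bexI[of _ "On r 1"]) auto
    next
      case False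
      then obtain m where m: "l = Suc m" "m \<ge> 1" using theta(2) by (cases l) auto
      then have km: "k = On p m" using 1 by (simp add: rootward_def)
      have "\<beta> - form \<beta> (simple k) *\<^sub>R simple i - form \<beta> (simple k) *\<^sub>R simple k = theta a b c k"
        unfolding y using theta m km theta_Suc[OF abc m(2)] by simp
      then show ?thesis using km unfolding elementary_shape_def by simp
    qed
  next
    case 2
    then have "k \<noteq> rootward p l" by (auto simp: rootward_def)
    then have y: "form \<beta> (simple k) = -1" using 2 theta abc k by (simp add: form_theta)
    have "\<beta> - form \<beta> (simple k) *\<^sub>R simple i - form \<beta> (simple k) *\<^sub>R simple k = theta a b c k"
      unfolding y using theta 2 theta_Suc[OF abc theta(2)] by simp
    then show ?thesis using 2 unfolding elementary_shape_def by simp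
  qed
qed


section \<open>The action of a simple reflection on the canonical basis\<close>

lemma reflect_vee:
  assumes "\<gamma> \<in> real_roots a b c"
  shows "act2 (reflection a b c \<gamma>) (vee \<alpha> \<beta>) =
    vee (\<alpha> - form \<gamma> \<alpha> *\<^sub>R \<gamma>) (\<beta> - form \<gamma> \<beta> *\<^sub>R \<gamma>)"
  by (simp add: act2_vee[OF linear_act[OF reflection_act(1)[OF assms]]] reflection_act(2)[OF assms])

text \<open>
  Since \<open>\<alpha>\<close> and \<open>\<gamma>\<close> span a root system of type \<open>A\<^sub>2\<close>, \<open>s\<^sub>\<alpha> s\<^sub>\<gamma>\<close> sends \<open>\<alpha>\<close> to \<open>\<gamma>\<close>. With \<open>\<beta>\<close>
  orthogonal to \<open>\<alpha>\<close>, it sends \<open>\<beta>\<close> to the very vector that appears in the difference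
  \<open>s\<^sub>\<gamma>(\<alpha> \<or> \<beta>) - \<alpha> \<or> \<beta>\<close>, as the next lemma shows.
\<close>

lemma reflect_twice_vee:
  assumes "\<alpha> \<in> real_roots a b c" "\<gamma> \<in> real_roots a b c"
    and "form \<alpha> \<beta> = 0" "form \<alpha> \<gamma> = -1"
  defines "w \<equiv> reflection a b c \<alpha> \<otimes>\<^bsub>cox_group a b c\<^esub> reflection a b c \<gamma>"
  shows "act w \<beta> = \<beta> - form \<beta> \<gamma> *\<^sub>R \<alpha> - form \<beta> \<gamma> *\<^sub>R \<gamma>"
    and "act2 w (vee \<alpha> \<beta>) = vee \<gamma> (\<beta> - form \<beta> \<gamma> *\<^sub>R \<alpha> - form \<beta> \<gamma> *\<^sub>R \<gamma>)"
    and "w \<in> carrier (cox_group a b c)"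
proof -
  interpret group "cox_group a b c" by (rule group_cox_group)
  note r = reflection_act[OF assms(1)] reflection_act[OF assms(2)]
  show w: "w \<in> carrier (cox_group a b c)" unfolding w_def using r by simp
  have aa: "form \<alpha> \<alpha> = 2" using assms(1) by (rule form_real_root)
  show b: "act w \<beta> = \<beta> - form \<beta> \<gamma> *\<^sub>R \<alpha> - form \<beta> \<gamma> *\<^sub>R \<gamma>"
    unfolding w_def using assms(3,4)
    by (simp add: act_mult r form_bilinear form_commute[of \<gamma>] algebra_simps)
  have "act w \<alpha> = \<gamma>"
    unfolding w_def using assms(4) aa
    by (simp add: act_mult r form_bilinear form_commute[of \<gamma>] algebra_simps)
  then show "act2 w (vee \<alpha> \<beta>) = vee \<gamma> (\<beta> - form \<beta> \<gamma> *\<^sub>R \<alpha> - form \<beta> \<gamma> *\<^sub>R \<gamma>)"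
    using b by (simp add: act2_vee[OF linear_act[OF w]])
qed

lemma reflect_vee_difference:
  assumes "\<gamma> \<in> real_roots a b c" "form \<alpha> \<gamma> = -1"
  shows "act2 (reflection a b c \<gamma>) (vee \<alpha> \<beta>) =
    vee \<alpha> \<beta> + vee \<gamma> (\<beta> - form \<beta> \<gamma> *\<^sub>R \<alpha> - form \<beta> \<gamma> *\<^sub>R \<gamma>)"
  using assms(2)
  by (simp add: reflect_vee[OF assms(1)] form_commute[of \<gamma>] vee_bilinear vee_commute[of \<gamma> \<alpha>]
      algebra_simps)

text \<open>
  When \<open>\<gamma>\<close> is adjacent to the simple factor \<open>\<alpha>\<close>, the new factor is the transport of \<open>\<beta>\<close>. When it is
  orthogonal to \<open>\<alpha>\<close>, the roles of \<open>\<alpha>\<close> and \<open>\<beta>\<close> are exchanged, and the two preceding lemmas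
  are applied with the root \<open>\<beta>\<close>, which need not be simple, in the first place.
\<close>

lemma reflect_elementary_pair:
  fixes a b c :: nat and \<alpha> \<beta> \<gamma> :: vec
  assumes abc: "a \<ge> 1" "b \<ge> 1" "c \<ge> 1"
    and pair: "elementary_pair a b c \<alpha> \<beta>"
    and "\<gamma> \<in> simple_roots a b c"
    and nonorth: "\<not> (form \<alpha> \<gamma> = 0 \<and> form \<beta> \<gamma> = 0)" and "\<gamma> \<notin> {\<alpha>, \<beta>}"
  shows "\<exists>v\<in>root_space a b c.
           vee \<gamma> v \<in> canonical_basis a b c \<and>
           act2 (reflection a b c \<gamma>) (vee \<alpha> \<beta>) = vee \<alpha> \<beta> + vee \<gamma> v \<and>
           (\<exists>w\<in>generate (cox_group a b c)
                 {reflection a b c \<alpha>, reflection a b c \<beta>, reflection a b c \<gamma>}.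
              act2 w (vee \<alpha> \<beta>) = vee \<gamma> v)"
proof -
  obtain i where i: "i \<in> vertices a b c" "\<alpha> = simple i" and shape: "elementary_shape a b c i \<beta>"
    and \<beta>: "\<beta> \<in> positive_roots a b c"
    using pair by (auto simp: elementary_pair_def elementary_iff_shape)
  obtain k where k: "k \<in> vertices a b c" "\<gamma> = simple k"
    using assms(5) by (auto simp: simple_roots_def)
  have roots: "\<alpha> \<in> real_roots a b c" "\<beta> \<in> real_roots a b c" "\<gamma> \<in> real_roots a b c"
    using i k \<beta> simple_real_root by (auto simp: positive_roots_def)
  have orth: "form \<beta> \<alpha> = 0" "form \<alpha> \<beta> = 0"
    using elementary_shape_orthogonal[OF abc i(1) shape] i form_commute by auto
  let ?G = "generate (cox_group a b c)
    {reflection a b c \<alpha>, reflection a b c \<beta>, reflection a b c \<gamma>}"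
  have "i \<noteq> k" using i k assms(7) by auto
  then consider "adj i k" | "cartan i k = 0"
    by (cases "adj i k") (auto simp: cartan_def)
  then show ?thesis
  proof cases
    case 1
    define v where "v = \<beta> - form \<beta> \<gamma> *\<^sub>R \<alpha> - form \<beta> \<gamma> *\<^sub>R \<gamma>"
    define w where "w = reflection a b c \<alpha> \<otimes>\<^bsub>cox_group a b c\<^esub> reflection a b c \<gamma>"
    have x: "form \<alpha> \<gamma> = -1"
      using 1 \<open>i \<noteq> k\<close> i k by (simp add: form_simple cartan_def)
    note tw = reflect_twice_vee[OF roots(1,3) orth(2) x, folded v_def w_def]
    have "w \<in> ?G" unfolding w_def by (intro generate.eng generate.incl) auto
    moreover have v_shape: "elementary_shape a b c k v"
      unfolding v_def i(2) k(2) by (rule elementary_shape_transport[OF abc i(1) k(1) shape 1])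
    have v_root: "v \<in> real_roots a b c"
      using real_root_act[OF roots(2) tw(3)] tw(1) by simp
    then have "v \<in> positive_roots a b c"
      using elementary_shape_nonneg[OF abc k(1) v_shape] by (simp add: positive_roots_def)
    then have "vee \<gamma> v \<in> canonical_basis a b c"
      using v_shape k by (auto simp: canonical_basis_def elementary_pair_def elementary_iff_shape)
    moreover have "act2 (reflection a b c \<gamma>) (vee \<alpha> \<beta>) = vee \<alpha> \<beta> + vee \<gamma> v"
      unfolding v_def by (rule reflect_vee_difference[OF roots(3) x])
    ultimately show ?thesis using tw(2) real_root_in_root_space[OF v_root] by blast
  next
    case 2
    define w where "w = reflection a b c \<beta> \<otimes>\<^bsub>cox_group a b c\<^esub> reflection a b c \<gamma>"
    have x: "form \<alpha> \<gamma> = 0" using 2 i k by (simp add: form_simple)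
    then have y: "form \<beta> \<gamma> = -1"
      using elementary_shape_pairing[OF abc i(1) k(1) shape 2] nonorth assms(7) k by auto
    note tw = reflect_twice_vee[OF roots(2,3) orth(1) y, folded w_def]
    have "w \<in> ?G" unfolding w_def by (intro generate.eng generate.incl) auto
    moreover have "act2 w (vee \<alpha> \<beta>) = vee \<gamma> \<alpha>"
      using tw(2) x by (simp add: vee_commute[of \<alpha> \<beta>])
    moreover have "act2 (reflection a b c \<gamma>) (vee \<alpha> \<beta>) = vee \<alpha> \<beta> + vee \<gamma> \<alpha>"
      using reflect_vee_difference[OF roots(3) y, of \<alpha>] x by (simp add: vee_commute[of \<beta> \<alpha>])
    moreover have "vee \<gamma> \<alpha> \<in> canonical_basis a b c"
    proof -
      have "\<alpha> \<in> positive_roots a b c"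
        using i roots by (simp add: positive_roots_def lookup_simple)
      then have "elementary_pair a b c \<gamma> \<alpha>"
        using i k 2 unfolding elementary_pair_def elementary_def by (metis cartan_commute)
      then show ?thesis unfolding canonical_basis_def by blast
    qed
    ultimately show ?thesis using real_root_in_root_space[OF roots(1)] by blast
  qed
qed

lemma reflect_elementary_pair_self:
  assumes abc: "a \<ge> 1" "b \<ge> 1" "c \<ge> 1"
    and pair: "elementary_pair a b c \<alpha> \<beta>" and "\<gamma> \<in> simple_roots a b c" and "\<gamma> \<in> {\<alpha>, \<beta>}"
  shows "act2 (reflection a b c \<gamma>) (vee \<alpha> \<beta>) = - vee \<alpha> \<beta>"
proof -
  obtain i where i: "i \<in> vertices a b c" "\<alpha> = simple i" and shape: "elementary_shape a b c i \<beta>"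
    using pair by (auto simp: elementary_pair_def elementary_iff_shape)
  have orth: "form \<beta> \<alpha> = 0" "form \<alpha> \<beta> = 0"
    using elementary_shape_orthogonal[OF abc i(1) shape] i form_commute by auto
  have root: "\<gamma> \<in> real_roots a b c"
    using assms(5) simple_real_root by (auto simp: simple_roots_def)
  have "\<delta> - form \<delta> \<delta> *\<^sub>R \<delta> = - \<delta>" if "form \<delta> \<delta> = 2" for \<delta>
    using that by (simp add: scaleR_2)
  moreover have "vee (- x) y = - vee x y" "vee x (- y) = - vee x y" for x y
    using vee_scaleR_left[of "-1" x y] vee_scaleR_right[of x "-1" y] by simp_all
  ultimately show ?thesis
    using assms(6) orth form_real_root[OF root] by (auto simp: reflect_vee[OF root])
qed

theorem theorem4p6:
  fixes a b c :: nat and \<alpha> \<beta> \<gamma> :: vec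
  assumes "a \<ge> 1" and "b \<ge> 1" and "c \<ge> 1"
    and "elementary_pair a b c \<alpha> \<beta> \<or> elementary_pair a b c \<beta> \<alpha>"
    and "\<gamma> \<in> simple_roots a b c"
  shows "(form \<alpha> \<gamma> = 0 \<and> form \<beta> \<gamma> = 0 \<longrightarrow>
            act2 (reflection a b c \<gamma>) (vee \<alpha> \<beta>) = vee \<alpha> \<beta>) \<and>
         (\<gamma> \<in> {\<alpha>, \<beta>} \<longrightarrow>
            act2 (reflection a b c \<gamma>) (vee \<alpha> \<beta>) = - vee \<alpha> \<beta>) \<and>
         (\<not> (form \<alpha> \<gamma> = 0 \<and> form \<beta> \<gamma> = 0) \<and> \<gamma> \<notin> {\<alpha>, \<beta>} \<longrightarrow>
            (\<exists>v\<in>root_space a b c.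
               vee \<gamma> v \<in> canonical_basis a b c \<and>
               act2 (reflection a b c \<gamma>) (vee \<alpha> \<beta>) = vee \<alpha> \<beta> + vee \<gamma> v \<and>
               (\<exists>w\<in>generate (cox_group a b c)
                     {reflection a b c \<alpha>, reflection a b c \<beta>, reflection a b c \<gamma>}.
                  act2 w (vee \<alpha> \<beta>) = vee \<gamma> v)))"
proof (intro conjI impI)
  have root: "\<gamma> \<in> real_roots a b c"
    using assms(5) simple_real_root by (auto simp: simple_roots_def)
  assume "form \<alpha> \<gamma> = 0 \<and> form \<beta> \<gamma> = 0"
  then show "act2 (reflection a b c \<gamma>) (vee \<alpha> \<beta>) = vee \<alpha> \<beta>"
    by (simp add: reflect_vee[OF root] form_commute[of \<gamma>])
next
  assume "\<gamma> \<in> {\<alpha>, \<beta>}"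
  then show "act2 (reflection a b c \<gamma>) (vee \<alpha> \<beta>) = - vee \<alpha> \<beta>"
    using reflect_elementary_pair_self[OF assms(1-3) _ assms(5), of \<alpha> \<beta>]
      reflect_elementary_pair_self[OF assms(1-3) _ assms(5), of \<beta> \<alpha>] assms(4)
    by (auto simp: vee_commute[of \<beta> \<alpha>])
next
  assume *: "\<not> (form \<alpha> \<gamma> = 0 \<and> form \<beta> \<gamma> = 0) \<and> \<gamma> \<notin> {\<alpha>, \<beta>}"
  show "\<exists>v\<in>root_space a b c.
     vee \<gamma> v \<in> canonical_basis a b c \<and>
     act2 (reflection a b c \<gamma>) (vee \<alpha> \<beta>) = vee \<alpha> \<beta> + vee \<gamma> v \<and>
     (\<exists>w\<in>generate (cox_group a b c)
           {reflection a b c \<alpha>, reflection a b c \<beta>, reflection a b c \<gamma>}.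
        act2 w (vee \<alpha> \<beta>) = vee \<gamma> v)"
    using assms(4)
  proof
    assume "elementary_pair a b c \<alpha> \<beta>"
    then show ?thesis using * by (intro reflect_elementary_pair[OF assms(1-3) _ assms(5)]) auto
  next
    assume "elementary_pair a b c \<beta> \<alpha>"
    then have "\<exists>v\<in>root_space a b c.
     vee \<gamma> v \<in> canonical_basis a b c \<and>
     act2 (reflection a b c \<gamma>) (vee \<beta> \<alpha>) = vee \<beta> \<alpha> + vee \<gamma> v \<and>
     (\<exists>w\<in>generate (cox_group a b c)
           {reflection a b c \<beta>, reflection a b c \<alpha>, reflection a b c \<gamma>}.
        act2 w (vee \<beta> \<alpha>) = vee \<gamma> v)"
      using * by (intro reflect_elementary_pair[OF assms(1-3) _ assms(5)]) auto
    moreover have "{reflection a b c \<beta>, reflection a b c \<alpha>, reflection a b c \<gamma>} =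
      {reflection a b c \<alpha>, reflection a b c \<beta>, reflection a b c \<gamma>}"
      by blast
    ultimately show ?thesis by (simp only: vee_commute[of \<beta> \<alpha>])
  qed
qed

end
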